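(* Let $X$ be a complex Hilbert space. Let $A_s$, $0\le s\le 1$, be a family of closed, densely defined, symmetric operators in $X$ with $\operatorname{dom}A_s=D_m$ and $\operatorname{dom}A_s^*=D_{\max}$ independent of $s$. Assume that $\{A_s^*:D_{\max}\to X\}_{s\in[0,1]}$ is a continuous curve of bounded operators, where the norm on $D_{\max}$ is the graph norm induced by $A_0^*$. If $A_0$ satisfies weak inner UCP and there exists a self-adjoint Fredholm extension $A_0^*|_D$ of $A_0$, then for all sufficiently small $s\ge 0$ the operators $A_s^*$ are surjective and the operators $A_s$ satisfy weak inner UCP.
   Context: A closed, densely defined symmetric operator $A$ in $X$ (i.e. $A\subset A^*$) satisfies the *weak inner Unique Continuation Property (UCP)* if $\ker A=\{0\}$. The graph norm on $D_{\max}$ induced by $A_0^*$ comes from the inner product $\langle x,y\rangle_X+\langle A_0^*x,A_0^*y\rangle_X$. Continuity of the curve of bounded operators is in operator norm. *)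

theory Defs
  imports "HOL-Analysis.Analysis"
begin

section \<open>Complex Hilbert spaces\<close>

text \<open>The norm, metric and topology come from the underlying real inner product space, whose inner
  product is the real part of the complex one; \<open>cinner\<close> is linear in its first argument.\<close>

class complex_hilbert_space = real_inner + complete_space +
  fixes scaleC :: "complex \<Rightarrow> 'a \<Rightarrow> 'a"  (infixr "*\<^sub>C" 75)
    and cinner :: "'a \<Rightarrow> 'a \<Rightarrow> complex"
  assumes scaleC_add_right: "a *\<^sub>C (x + y) = a *\<^sub>C x + a *\<^sub>C y"
    and scaleC_add_left: "(a + b) *\<^sub>C x = a *\<^sub>C x + b *\<^sub>C x"
    and scaleC_scaleC: "a *\<^sub>C (b *\<^sub>C x) = (a * b) *\<^sub>C x"
    and scaleR_scaleC: "r *\<^sub>R x = complex_of_real r *\<^sub>C x"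
    and cinner_commute: "cinner x y = cnj (cinner y x)"
    and cinner_add_left: "cinner (x + y) z = cinner x z + cinner y z"
    and cinner_scaleC_left: "cinner (a *\<^sub>C x) y = a * cinner x y"
    and inner_eq_Re_cinner: "inner x y = Re (cinner x y)"

global_interpretation complex_vector: vector_space "scaleC :: complex \<Rightarrow> 'a \<Rightarrow> 'a::complex_hilbert_space"
  by unfold_locales
    (simp_all add: scaleC_add_right scaleC_add_left scaleC_scaleC scaleR_scaleC [of 1, simplified, symmetric])

instantiation complex :: complex_hilbert_space
begin

definition "a *\<^sub>C (x :: complex) = a * x"
definition "cinner (x :: complex) y = x * cnj y"

instance
  by standard
    (simp_all add: scaleC_complex_def cinner_complex_def inner_complex_def algebra_simps
      scaleR_conv_of_real)

end

section \<open>Unbounded operators\<close>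

text \<open>A possibly unbounded operator in \<open>X\<close> is represented by its graph, a subset of \<open>X \<times> X\<close>: its domain
  is \<^const>\<open>Domain\<close>, its range \<^const>\<open>Range\<close>, closedness is \<^const>\<open>closed\<close> in the product topology,
  and \<open>A \<subseteq> B\<close> says that \<open>B\<close> extends \<open>A\<close>.\<close>

type_synonym 'a op_graph = "('a \<times> 'a) set"

definition linear_op :: "'a::complex_hilbert_space op_graph \<Rightarrow> bool" where
  "linear_op A \<longleftrightarrow> single_valued A \<and> (0, 0) \<in> A
     \<and> (\<forall>x y x' y'. (x, y) \<in> A \<longrightarrow> (x', y') \<in> A \<longrightarrow> (x + x', y + y') \<in> A)
     \<and> (\<forall>c x y. (x, y) \<in> A \<longrightarrow> (c *\<^sub>C x, c *\<^sub>C y) \<in> A)"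

definition densely_defined :: "'a::complex_hilbert_space op_graph \<Rightarrow> bool" where
  "densely_defined A \<longleftrightarrow> closure (Domain A) = UNIV"

definition op_app :: "'a op_graph \<Rightarrow> 'a \<Rightarrow> 'a" where
  "op_app A x = (THE y. (x, y) \<in> A)"

definition op_ker :: "'a::zero op_graph \<Rightarrow> 'a set" where
  "op_ker A = {x. (x, 0) \<in> A}"

definition op_restrict :: "'a op_graph \<Rightarrow> 'a set \<Rightarrow> 'a op_graph" where
  "op_restrict A D = {(x, y) \<in> A. x \<in> D}"

text \<open>The adjoint is again (the graph of) an operator precisely when \<open>A\<close> is densely defined.\<close>

definition adjoint_op :: "'a::complex_hilbert_space op_graph \<Rightarrow> 'a op_graph" where
  "adjoint_op A = {(y, z). \<forall>(x, w) \<in> A. cinner w y = cinner x z}"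

definition symmetric_op :: "'a::complex_hilbert_space op_graph \<Rightarrow> bool" where
  "symmetric_op A \<longleftrightarrow> A \<subseteq> adjoint_op A"

definition selfadjoint_op :: "'a::complex_hilbert_space op_graph \<Rightarrow> bool" where
  "selfadjoint_op A \<longleftrightarrow> linear_op A \<and> densely_defined A \<and> adjoint_op A = A"

definition fin_dim :: "'a::complex_hilbert_space set \<Rightarrow> bool" where
  "fin_dim S \<longleftrightarrow> (\<exists>B. finite B \<and> S \<subseteq> complex_vector.span B)"

definition fin_codim :: "'a::complex_hilbert_space set \<Rightarrow> bool" where
  "fin_codim S \<longleftrightarrow> (\<exists>B. finite B \<and> complex_vector.span (S \<union> B) = UNIV)"

definition fredholm_op :: "'a::complex_hilbert_space op_graph \<Rightarrow> bool" where
  "fredholm_op A \<longleftrightarrow> linear_op A \<and> closed A \<and> fin_dim (op_ker A)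
     \<and> closed (Range A) \<and> fin_codim (Range A)"

definition weak_inner_UCP :: "'a::complex_hilbert_space op_graph \<Rightarrow> bool" where
  "weak_inner_UCP A \<longleftrightarrow> op_ker A = {0}"

section \<open>Operator-norm continuity with respect to a graph norm\<close>

definition graph_inner :: "'a::complex_hilbert_space op_graph \<Rightarrow> 'a \<Rightarrow> 'a \<Rightarrow> complex" where
  "graph_inner T x y = cinner x y + cinner (op_app T x) (op_app T y)"

definition graph_norm :: "'a::complex_hilbert_space op_graph \<Rightarrow> 'a \<Rightarrow> real" where
  "graph_norm T x = sqrt (Re (graph_inner T x x))"

text \<open>Below, \<open>N\<close> is a norm on the subspace \<open>D\<close>, and maps are only considered on \<open>D\<close>.\<close>

definition bounded_wrt :: "'a set \<Rightarrow> ('a \<Rightarrow> real) \<Rightarrow> ('a \<Rightarrow> 'b::real_normed_vector) \<Rightarrow> bool" where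
  "bounded_wrt D N f \<longleftrightarrow> (\<exists>C. \<forall>x\<in>D. norm (f x) \<le> C * N x)"

definition opnorm_wrt :: "'a set \<Rightarrow> ('a \<Rightarrow> real) \<Rightarrow> ('a \<Rightarrow> 'b::real_normed_vector) \<Rightarrow> real" where
  "opnorm_wrt D N f = (SUP x\<in>{x\<in>D. N x \<le> 1}. norm (f x))"

definition continuous_bounded_curve ::
    "real set \<Rightarrow> 'a set \<Rightarrow> ('a \<Rightarrow> real) \<Rightarrow> (real \<Rightarrow> 'a \<Rightarrow> 'b::real_normed_vector) \<Rightarrow> bool" where
  "continuous_bounded_curve I D N F \<longleftrightarrow>
     (\<forall>s\<in>I. bounded_wrt D N (F s)) \<and>
     (\<forall>s\<in>I. ((\<lambda>t. opnorm_wrt D N (\<lambda>x. F t x - F s x)) \<longlongrightarrow> 0) (at s within I))"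

end

theory Submission
  imports Defs
begin

text \<open>
  Surjectivity of \<open>A\<^sup>*\<close>, for a closed operator \<open>A\<close>, is equivalent to a lower bound
  \<open>\<parallel>x\<parallel> \<le> C \<parallel>A x\<parallel>\<close> on the domain of \<open>A\<close>. The lower bound also gives \<open>ker A = {0}\<close>, and unlike
  surjectivity it is visibly stable under small perturbations. The proof translates the situation at
  \<open>s = 0\<close> into a lower bound for \<open>A\<^sub>0\<close>, perturbs the bound, and translates back for each small \<open>s\<close>.

  At \<open>s = 0\<close>, the range of \<open>A\<^sub>0\<^sup>*\<close> contains the range of the Fredholm extension. A subspace that
  contains a closed subspace of finite codimension is closed (\<open>closed_superspace_of_fin_codim\<close>). The
  orthogonal complement of the range of \<open>A\<^sub>0\<^sup>*\<close> lies in \<open>ker A\<^sub>0\<^sup>*\<^sup>* = ker A\<^sub>0 = {0}\<close>, so \<open>A\<^sub>0\<^sup>*\<close>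
  is surjective (\<open>Range_adjoint_op_eq_UNIV\<close>). The uniform boundedness principle then yields the lower
  bound for \<open>A\<^sub>0\<close> (\<open>adjoint_op_surj_imp_bounded_below\<close>).

  By symmetry \<open>A\<^sub>s - A\<^sub>0\<close> is a restriction of \<open>A\<^sub>s\<^sup>* - A\<^sub>0\<^sup>*\<close>, whose norm with respect to the graph
  norm of \<open>A\<^sub>0\<^sup>*\<close> tends to 0. On the domain of \<open>A\<^sub>0\<close> this graph norm is at most
  \<open>(C + 1) \<parallel>A\<^sub>0 x\<parallel>\<close>, so \<open>\<parallel>A\<^sub>s x\<parallel> \<ge> \<parallel>A\<^sub>0 x\<parallel> / 2\<close> for small \<open>s\<close> (\<open>norm_le_of_graph_norm_close\<close>).
  Hence \<open>A\<^sub>s\<close> has a lower bound and is injective, and a Riesz representation argument on its range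
  shows that \<open>A\<^sub>s\<^sup>*\<close> is surjective (\<open>bounded_below_imp_adjoint_op_surj\<close>). Everything rests on
  orthogonal projection onto closed subspaces, in \<open>X\<close> and, for \<open>ker A\<^sub>0\<^sup>*\<^sup>* = ker A\<^sub>0\<close>, in \<open>X \<times> X\<close>.
\<close>

section \<open>Orthogonal projection\<close>

text \<open>The nearest point of \<open>S\<close>: a minimizing sequence is Cauchy by the parallelogram law, and at the
  minimum the first variation along \<open>S\<close> vanishes. The real form is used because it also applies to
  graphs, seen as subspaces of a product space.\<close>

lemma orthogonal_decomposition:
  fixes S :: "'a::{real_inner,complete_space} set"
  assumes S: "subspace S" "closed S"
  obtains s where "s \<in> S" "\<And>t. t \<in> S \<Longrightarrow> inner (x - s) t = 0"
proof -
  define d where "d = infdist x S"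
  have ne: "S \<noteq> {}" using S(1) subspace_0 by auto
  have d0: "d \<ge> 0" by (simp add: d_def infdist_nonneg)
  have dle: "d \<le> dist x t" if "t \<in> S" for t
    using that by (simp add: d_def infdist_le)
  have "\<exists>t\<in>S. dist x t < d + inverse (real (Suc n))" for n
  proof (rule ccontr)
    assume "\<not> ?thesis"
    then have "d + inverse (real (Suc n)) \<le> (INF t\<in>S. dist x t)"
      by (intro cINF_greatest[OF ne]) (auto simp: not_less)
    moreover have "d = (INF t\<in>S. dist x t)" using ne by (simp add: d_def infdist_def)
    ultimately show False by simp
  qed
  then obtain u where u: "\<And>n. u n \<in> S" "\<And>n. dist x (u n) < d + inverse (real (Suc n))"
    by metis
  have parallelogram: "(dist a b)\<^sup>2 \<le> 2 * (dist x a)\<^sup>2 + 2 * (dist x b)\<^sup>2 - 4 * d\<^sup>2"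
    if "a \<in> S" "b \<in> S" for a b
  proof -
    have "(1/2) *\<^sub>R (a + b) \<in> S" using that S(1) by (simp add: subspace_add subspace_scale)
    then have "d\<^sup>2 \<le> (dist x ((1/2) *\<^sub>R (a + b)))\<^sup>2"
      using d0 dle by (simp add: power_mono)
    moreover have "(dist a b)\<^sup>2 = 2 * (dist x a)\<^sup>2 + 2 * (dist x b)\<^sup>2 - 4 * (dist x ((1/2) *\<^sub>R (a + b)))\<^sup>2"
      by (simp add: dist_norm power2_norm_eq_inner algebra_simps inner_commute)
    ultimately show ?thesis by linarith
  qed
  have lim: "(\<lambda>n. (d + inverse (real (Suc n)))\<^sup>2) \<longlonglongrightarrow> d\<^sup>2"
    using tendsto_power[OF tendsto_add[OF tendsto_const LIMSEQ_inverse_real_of_nat], of d 2] by simp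
  have "Cauchy u"
  proof (rule metric_CauchyI)
    fix e :: real assume e: "e > 0"
    then have "\<forall>\<^sub>F n in sequentially. (d + inverse (real (Suc n)))\<^sup>2 < d\<^sup>2 + e\<^sup>2 / 4"
      using order_tendstoD(2)[OF lim, of "d\<^sup>2 + e\<^sup>2/4"] by simp
    then obtain N where N: "\<And>n. n \<ge> N \<Longrightarrow> (d + inverse (real (Suc n)))\<^sup>2 < d\<^sup>2 + e\<^sup>2 / 4"
      by (auto simp: eventually_sequentially)
    have b: "(dist x (u n))\<^sup>2 < d\<^sup>2 + e\<^sup>2 / 4" if "n \<ge> N" for n
    proof -
      have "(dist x (u n))\<^sup>2 \<le> (d + inverse (real (Suc n)))\<^sup>2"
        using less_imp_le[OF u(2)] by (intro power_mono) auto
      then show ?thesis using N[OF that] by linarith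
    qed
    have "dist (u m) (u n) < e" if "m \<ge> N" "n \<ge> N" for m n
    proof -
      have "(dist (u m) (u n))\<^sup>2 < e\<^sup>2"
        using parallelogram[OF u(1) u(1), of m n] b[OF that(1)] b[OF that(2)] by linarith
      then show ?thesis using e power_less_imp_less_base by fastforce
    qed
    then show "\<exists>M. \<forall>m\<ge>M. \<forall>n\<ge>M. dist (u m) (u n) < e" by blast
  qed
  then obtain s where s: "u \<longlonglongrightarrow> s"
    using Cauchy_convergent_iff convergent_def by blast
  have sS: "s \<in> S" using S(2) u(1) s closed_sequentially by blast
  have "dist x s \<le> d"
  proof (rule LIMSEQ_le)
    show "(\<lambda>n. dist x (u n)) \<longlonglongrightarrow> dist x s" by (intro tendsto_intros s)
    show "(\<lambda>n. d + inverse (real (Suc n))) \<longlonglongrightarrow> d"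
      using tendsto_add[OF tendsto_const LIMSEQ_inverse_real_of_nat, of d] by simp
    show "\<exists>N. \<forall>n\<ge>N. dist x (u n) \<le> d + inverse (real (Suc n))" using u(2) less_imp_le by blast
  qed
  have "inner (x - s) t = 0" if t: "t \<in> S" for t
  proof (cases "t = 0")
    case False
    define r where "r = inner (x - s) t / inner t t"
    have "s + r *\<^sub>R t \<in> S" using sS t S(1) by (simp add: subspace_add subspace_scale)
    then have "dist x s \<le> dist x (s + r *\<^sub>R t)" using dle \<open>dist x s \<le> d\<close> by fastforce
    then have "inner (x - s) (x - s) \<le> inner (x - s - r *\<^sub>R t) (x - s - r *\<^sub>R t)"
      by (simp add: dist_norm norm_le diff_diff_add)
    also have "\<dots> = inner (x - s) (x - s) - 2 * r * inner (x - s) t + r * r * inner t t"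
      by (simp add: inner_diff_left inner_diff_right inner_commute algebra_simps)
    also have "\<dots> = inner (x - s) (x - s) - (inner (x - s) t)\<^sup>2 / inner t t"
      using False by (simp add: r_def power2_eq_square field_simps)
    finally have "(inner (x - s) t)\<^sup>2 / inner t t \<le> 0" by simp
    moreover have "inner t t > 0" using False by simp
    ultimately show ?thesis by (simp add: divide_le_0_iff)
  qed simp
  with sS that show thesis by blast
qed

section \<open>The complex inner product\<close>

lemma cinner_add_right: "cinner x (y + z) = cinner x y + cinner x z"
  by (metis cinner_add_left cinner_commute complex_cnj_add)

lemma cinner_scaleC_right: "cinner x (a *\<^sub>C y) = cnj a * cinner x y"
  by (metis cinner_scaleC_left cinner_commute complex_cnj_mult)

lemma cinner_zero_left [simp]: "cinner 0 x = 0"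
  using cinner_add_left[of 0 0 x] by simp

lemma cinner_zero_right [simp]: "cinner x 0 = 0"
  using cinner_add_right[of x 0 0] by simp

lemma cinner_minus_left: "cinner (- x) y = - cinner x y"
  using cinner_add_left[of x "- x" y] by (simp add: add_eq_0_iff)

lemma cinner_minus_right: "cinner x (- y) = - cinner x y"
  using cinner_add_right[of x y "- y"] by (simp add: add_eq_0_iff)

lemma cinner_diff_left: "cinner (x - y) z = cinner x z - cinner y z"
  using cinner_add_left[of x "- y" z] by (simp add: cinner_minus_left)

lemma cinner_diff_right: "cinner x (y - z) = cinner x y - cinner x z"
  using cinner_add_right[of x y "- z"] by (simp add: cinner_minus_right)

lemma cinner_eq_inner: "cinner x y = Complex (inner x y) (inner x (\<i> *\<^sub>C y))"
  by (simp add: complex_eq_iff inner_eq_Re_cinner cinner_scaleC_right)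

lemma cinner_self: "cinner x x = of_real ((norm x)\<^sup>2)"
  using cinner_commute[of x x] 
  by (simp add: complex_eq_iff power2_norm_eq_inner inner_eq_Re_cinner)

lemma continuous_on_cinner_left [continuous_intros]:
  "continuous_on S f \<Longrightarrow> continuous_on S (\<lambda>x. cinner (f x) y)"
  unfolding cinner_eq_inner Complex_eq by (intro continuous_intros)

lemma continuous_on_scaleC_left [continuous_intros]:
  fixes v :: "'a::complex_hilbert_space"
  assumes "continuous_on S f"
  shows "continuous_on S (\<lambda>x. f x *\<^sub>C v)"
proof -
  have eq: "c *\<^sub>C v = Re c *\<^sub>R v + Im c *\<^sub>R (\<i> *\<^sub>C v)" for c
    unfolding scaleR_scaleC scaleC_scaleC scaleC_add_left[symmetric]
    using complex_eq[of c] by (simp add: mult.commute)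
  show ?thesis unfolding eq[of "f _"] by (intro continuous_intros assms)
qed

lemma complex_subspace_imp_subspace:
  assumes "complex_vector.subspace S"
  shows "subspace S"
  using assms unfolding subspace_def complex_vector.subspace_def
  by (simp add: scaleR_scaleC)

text \<open>On a complex subspace the imaginary part of the inner product is the real part at a multiple
  by the imaginary unit, so real and complex orthogonality agree.\<close>

lemma complex_orthogonal_decomposition:
  fixes S :: "'a::complex_hilbert_space set"
  assumes S: "complex_vector.subspace S" "closed S"
  obtains s where "s \<in> S" "\<And>t. t \<in> S \<Longrightarrow> cinner t (x - s) = 0"
proof -
  obtain s where s: "s \<in> S" "\<And>t. t \<in> S \<Longrightarrow> inner (x - s) t = 0"
    using orthogonal_decomposition[OF complex_subspace_imp_subspace[OF S(1)] S(2), of x] by metis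
  have "cinner t (x - s) = 0" if t: "t \<in> S" for t
  proof -
    have "\<i> *\<^sub>C t \<in> S" using S(1) t by (simp add: complex_vector.subspace_scale)
    with t have "Re (cinner t (x - s)) = 0" "Re (cinner (\<i> *\<^sub>C t) (x - s)) = 0"
      using s(2) by (simp_all flip: inner_eq_Re_cinner add: inner_commute)
    then show ?thesis by (simp add: complex_eq_iff cinner_scaleC_left)
  qed
  with s(1) that show thesis by blast
qed

section \<open>Closed subspaces of finite codimension\<close>

text \<open>Replace \<open>v\<close> by its component \<open>p\<close> orthogonal to \<open>M\<close>: the coefficient along \<open>p\<close> is then a
  continuous function of the vector, and the span is a preimage of \<open>M\<close>.\<close>

lemma closed_span_insert:
  fixes M :: "'a::complex_hilbert_space set"
  assumes M: "complex_vector.subspace M" "closed M"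
  shows "closed (complex_vector.span (insert v M))"
proof -
  obtain m where m: "m \<in> M" and orth: "\<And>t. t \<in> M \<Longrightarrow> cinner t (v - m) = 0"
    using complex_orthogonal_decomposition[OF M] by metis
  define p where "p = v - m"
  define P where "P x = x - (cinner x p / cinner p p) *\<^sub>C p" for x
  have iff: "x - k *\<^sub>C v \<in> M \<longleftrightarrow> x - k *\<^sub>C p \<in> M" for x k
  proof -
    have "x - k *\<^sub>C p = (x - k *\<^sub>C v) + k *\<^sub>C m"
      by (simp add: p_def complex_vector.scale_right_diff_distrib)
    moreover have "k *\<^sub>C m \<in> M" using m M(1) by (rule complex_vector.subspace_scale[rotated])
    ultimately show ?thesis
      using complex_vector.subspace_add[OF M(1)] complex_vector.subspace_diff[OF M(1)]
      by (metis add_diff_cancel_right')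
  qed
  have P: "P x = x - k *\<^sub>C p" if "x - k *\<^sub>C p \<in> M" for x k
  proof (cases "p = 0")
    case False
    have "cinner x p - k * cinner p p = 0"
      using orth[OF that] by (simp add: p_def[symmetric] cinner_diff_left cinner_scaleC_left)
    moreover have "cinner p p \<noteq> 0" using False by (simp add: cinner_self)
    ultimately show ?thesis by (simp add: P_def)
  qed (simp add: P_def)
  have "x \<in> complex_vector.span (insert v M) \<longleftrightarrow> P x \<in> M" for x
  proof -
    have "x \<in> complex_vector.span (insert v M) \<longleftrightarrow> (\<exists>k. x - k *\<^sub>C p \<in> M)"
      unfolding complex_vector.span_insert complex_vector.span_eq_iff[THEN iffD2, OF M(1)]
      by (simp only: iff mem_Collect_eq)
    also have "\<dots> \<longleftrightarrow> P x \<in> M"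
    proof
      assume "\<exists>k. x - k *\<^sub>C p \<in> M"
      then obtain k where k: "x - k *\<^sub>C p \<in> M" ..
      show "P x \<in> M" unfolding P[OF k] by (rule k)
    next
      assume "P x \<in> M"
      then show "\<exists>k. x - k *\<^sub>C p \<in> M" unfolding P_def ..
    qed
    finally show ?thesis .
  qed
  then have "complex_vector.span (insert v M) = P -` M" by blast
  moreover have "continuous_on UNIV P"
    unfolding P_def divide_inverse by (intro continuous_intros)
  then have "closed (P -` M)" using M(2) by (rule closed_vimage[rotated])
  ultimately show ?thesis by (simp only:)
qed

text \<open>Induction on \<open>F\<close>: adding one vector to \<open>F\<close> enlarges \<open>R \<inter> span (M \<union> F)\<close> by at most one
  dimension.\<close>

lemma closed_Int_span_finite:
  fixes M R :: "'a::complex_hilbert_space set"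
  assumes M: "complex_vector.subspace M" "closed M"
    and R: "complex_vector.subspace R" "M \<subseteq> R"
    and "finite F"
  shows "closed (R \<inter> complex_vector.span (M \<union> F))"
  using \<open>finite F\<close>
proof induction
  case empty
  have "complex_vector.span M = M" using M(1) by (simp only: complex_vector.span_eq_iff)
  moreover have "R \<inter> M = M" using R(2) by (rule Int_absorb1)
  ultimately show ?case using M(2) by (simp only: Un_empty_right)
next
  case (insert f F)
  let ?S = "complex_vector.span (M \<union> F)" and ?T = "complex_vector.span (M \<union> insert f F)"
  have ST: "?S \<subseteq> ?T" by (intro complex_vector.span_mono) auto
  have sub: "complex_vector.subspace (R \<inter> ?S)"
    by (rule complex_vector.subspace_inter[OF R(1) complex_vector.subspace_span])
  show ?case
  proof (cases "R \<inter> ?T \<subseteq> ?S")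
    case True
    then have "R \<inter> ?T = R \<inter> ?S" using ST by blast
    then show ?thesis using insert.IH by (simp only:)
  next
    case False
    then obtain r where r: "r \<in> R" "r \<in> ?T" "r \<notin> ?S" by blast
    have "R \<inter> ?T = complex_vector.span (insert r (R \<inter> ?S))"
    proof
      show "R \<inter> ?T \<subseteq> complex_vector.span (insert r (R \<inter> ?S))"
      proof
        fix x assume x: "x \<in> R \<inter> ?T"
        have "f \<in> complex_vector.span (insert r (M \<union> F))"
          using r(2,3) unfolding Un_insert_right by (rule complex_vector.in_span_insert)
        then have "?T \<subseteq> complex_vector.span (insert r (M \<union> F))"
          using complex_vector.span_superset[of "insert r (M \<union> F)"]
          by (intro complex_vector.span_minimal complex_vector.subspace_span) blast
        then obtain k where k: "x - k *\<^sub>C r \<in> ?S"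
          using x unfolding complex_vector.span_insert[of r "M \<union> F"] by blast
        have "k *\<^sub>C r \<in> R" using R(1) r(1) by (rule complex_vector.subspace_scale)
        then have "x - k *\<^sub>C r \<in> R \<inter> ?S"
          using x k complex_vector.subspace_diff[OF R(1), of x "k *\<^sub>C r"] by blast
        then have "x - k *\<^sub>C r \<in> complex_vector.span (R \<inter> ?S)"
          by (rule complex_vector.span_base)
        then show "x \<in> complex_vector.span (insert r (R \<inter> ?S))"
          unfolding complex_vector.span_insert[of r "R \<inter> ?S"] by blast
      qed
      show "complex_vector.span (insert r (R \<inter> ?S)) \<subseteq> R \<inter> ?T"
        using r(1,2) ST
        by (intro complex_vector.span_minimal complex_vector.subspace_inter R(1)
              complex_vector.subspace_span) blast
    qed
    then show ?thesis using closed_span_insert[OF sub insert.IH] by (simp only:)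
  qed
qed

lemma closed_superspace_of_fin_codim:
  fixes M R :: "'a::complex_hilbert_space set"
  assumes "complex_vector.subspace M" "closed M" "fin_codim M"
    and "complex_vector.subspace R" "M \<subseteq> R"
  shows "closed R"
proof -
  obtain F where F: "finite F" "complex_vector.span (M \<union> F) = UNIV"
    using assms(3) by (auto simp: fin_codim_def)
  have "closed (R \<inter> complex_vector.span (M \<union> F))"
    by (rule closed_Int_span_finite) (use assms F in auto)
  then show ?thesis using F(2) by simp
qed

section \<open>Operators and adjoints\<close>

lemma linear_op_imp_subspace: "linear_op A \<Longrightarrow> subspace A"
  unfolding linear_op_def subspace_def by (auto simp: scaleR_scaleC zero_prod_def)

lemma subspace_Range:
  fixes A :: "'a::complex_hilbert_space op_graph"
  assumes "(0, 0) \<in> A"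
    and "\<And>x y x' y'. (x, y) \<in> A \<Longrightarrow> (x', y') \<in> A \<Longrightarrow> (x + x', y + y') \<in> A"
    and "\<And>c x y. (x, y) \<in> A \<Longrightarrow> (c *\<^sub>C x, c *\<^sub>C y) \<in> A"
  shows "complex_vector.subspace (Range A)"
proof (rule complex_vector.subspaceI)
  show "0 \<in> Range A" using assms(1) by blast
  show "y + y' \<in> Range A" if "y \<in> Range A" "y' \<in> Range A" for y y'
    using that assms(2) by blast
  show "c *\<^sub>C y \<in> Range A" if "y \<in> Range A" for c y
    using that assms(3) by blast
qed

lemma linear_op_imp_subspace_Range: "linear_op A \<Longrightarrow> complex_vector.subspace (Range A)"
  by (rule subspace_Range) (simp_all add: linear_op_def)

lemma subspace_Range_adjoint_op: "complex_vector.subspace (Range (adjoint_op A))"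
  by (rule subspace_Range)
    (fastforce simp: adjoint_op_def cinner_add_right cinner_scaleC_right)+

lemma linear_op_adjoint_op:
  assumes "densely_defined A"
  shows "linear_op (adjoint_op A)"
proof -
  have "z = z'" if "(y, z) \<in> adjoint_op A" "(y, z') \<in> adjoint_op A" for y z z'
  proof -
    \<comment> \<open>The difference of two values is orthogonal to the dense domain, hence to itself.\<close>
    have "Domain A \<subseteq> {x. cinner x (z - z') = 0}"
      using that by (fastforce simp: adjoint_op_def cinner_diff_right)
    moreover have "closed {x. cinner x (z - z') = 0}"
      by (intro closed_Collect_eq continuous_intros)
    ultimately have "closure (Domain A) \<subseteq> {x. cinner x (z - z') = 0}"
      by (rule closure_minimal)
    then have "cinner (z - z') (z - z') = 0"
      using assms by (auto simp: densely_defined_def)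
    then show ?thesis by (simp add: cinner_self)
  qed
  then have "single_valued (adjoint_op A)" by (auto simp: single_valued_def)
  then show ?thesis
    by (fastforce simp: linear_op_def adjoint_op_def cinner_add_right cinner_scaleC_right)
qed

lemma op_app_eq: "single_valued T \<Longrightarrow> (x, y) \<in> T \<Longrightarrow> op_app T x = y"
  unfolding op_app_def by (auto dest: single_valuedD)

text \<open>This is the inclusion \<open>A\<^sup>*\<^sup>* \<subseteq> A\<close> restricted to pairs \<open>(v, 0)\<close>. The component \<open>(p, q)\<close> of
  \<open>(v, 0)\<close> orthogonal to the graph of \<open>A\<close> gives a pair \<open>(q, -p)\<close> in the graph of the adjoint, and
  then \<open>v\<close> being orthogonal to \<open>-p\<close> forces \<open>(p, q)\<close> to be orthogonal to itself.\<close>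

lemma orthogonal_Range_adjoint_op_imp_ker:
  assumes A: "linear_op A" "closed A"
    and v: "\<And>z. z \<in> Range (adjoint_op A) \<Longrightarrow> cinner z v = 0"
  shows "v \<in> op_ker A"
proof -
  obtain s where "s \<in> A" "\<And>t. t \<in> A \<Longrightarrow> inner ((v, 0) - s) t = 0"
    using orthogonal_decomposition[OF linear_op_imp_subspace[OF A(1)] A(2)] by metis
  then obtain a b where ab: "(a, b) \<in> A"
    and orth: "\<And>x w. (x, w) \<in> A \<Longrightarrow> inner (v - a) x + inner (- b) w = 0"
    by (cases s) (fastforce simp: inner_prod_def)
  define p q where "p = v - a" and "q = - b"
  have "cinner x p + cinner w q = 0" if xw: "(x, w) \<in> A" for x w
  proof -
    have "(\<i> *\<^sub>C x, \<i> *\<^sub>C w) \<in> A" using A(1) xw by (simp add: linear_op_def)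
    then have "Re (cinner (\<i> *\<^sub>C x) p + cinner (\<i> *\<^sub>C w) q) = 0" "Re (cinner x p + cinner w q) = 0"
      using orth[OF xw] orth[of "\<i> *\<^sub>C x" "\<i> *\<^sub>C w"]
      by (simp_all flip: inner_eq_Re_cinner add: p_def q_def inner_commute)
    then show ?thesis by (simp add: complex_eq_iff cinner_scaleC_left)
  qed
  then have "(q, - p) \<in> adjoint_op A"
    by (auto simp: adjoint_op_def cinner_minus_right add_eq_0_iff)
  then have "cinner p v = 0" using v[of "- p"] by (auto simp: cinner_minus_left)
  then have "inner p v = 0" by (simp add: inner_eq_Re_cinner)
  moreover have "inner p a + inner q b = 0" using orth[OF ab] by (simp add: p_def q_def)
  ultimately have "inner p p + inner q q = 0"
    by (simp add: p_def q_def inner_diff_right)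
  moreover have "inner p p \<ge> 0" "inner q q \<ge> 0" by simp_all
  ultimately have "inner p p = 0" "inner q q = 0" by linarith+
  then have "p = 0" "q = 0" by simp_all
  then show ?thesis using ab by (simp add: p_def q_def op_ker_def)
qed

text \<open>The range of \<open>A\<^sup>*\<close> has orthogonal complement \<open>ker A\<close>, so once it is closed, injectivity of
  \<open>A\<close> is all that surjectivity of \<open>A\<^sup>*\<close> asks for.\<close>

lemma Range_adjoint_op_eq_UNIV:
  assumes A: "linear_op A" "closed A" and ker: "op_ker A = {0}"
    and R: "closed (Range (adjoint_op A))"
  shows "Range (adjoint_op A) = UNIV"
proof -
  have "x \<in> Range (adjoint_op A)" for x
  proof -
    obtain s where s: "s \<in> Range (adjoint_op A)"
      "\<And>t. t \<in> Range (adjoint_op A) \<Longrightarrow> cinner t (x - s) = 0"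
      using complex_orthogonal_decomposition[OF subspace_Range_adjoint_op R] by metis
    then have "x - s \<in> op_ker A" by (intro orthogonal_Range_adjoint_op_imp_ker[OF A])
    then show ?thesis using s(1) ker by simp
  qed
  then show ?thesis by blast
qed

section \<open>Surjectivity of the adjoint and lower bounds\<close>

text \<open>This is the uniform boundedness principle for inner products. By Baire's theorem some set
  \<open>F n\<close> of the proof contains a ball. Both its centre and its boundary points \<open>y0 + r *\<^sub>R sgn x\<close> pair
  with \<open>x\<close> to at most \<open>n\<close>, and their difference pairs with \<open>x\<close> to \<open>r * norm x\<close>.\<close>

lemma weakly_bounded_imp_norm_bounded:
  fixes S :: "'a::{real_inner,complete_space} set"
  assumes "\<And>y. \<exists>K. \<forall>x\<in>S. \<bar>inner x y\<bar> \<le> K"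
  shows "\<exists>K. \<forall>x\<in>S. norm x \<le> K"
proof -
  define F where "F n = (\<Inter>x\<in>S. {y. \<bar>inner x y\<bar> \<le> real n})" for n :: nat
  have clF: "closed (F n)" for n
    unfolding F_def by (intro closed_INT ballI closed_Collect_le continuous_intros)
  have "y \<in> (\<Union>n. F n)" for y
  proof -
    obtain K where "\<forall>x\<in>S. \<bar>inner x y\<bar> \<le> K" using assms by blast
    moreover obtain n where "K \<le> real n" using real_arch_simple by blast
    ultimately have "y \<in> F n" by (force simp: F_def)
    then show ?thesis by blast
  qed
  then have "(\<Union>n. F n) = UNIV" by blast
  moreover have "interior (\<Union>n. F n) = {}" if "\<And>n. interior (F n) = {}"
    using Met_TC.metric_Baire_category_alt[where \<G> = "range F"] clF that
    by (auto simp: complete_UNIV interior_of_eq)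
  ultimately obtain n where "interior (F n) \<noteq> {}" by auto
  then obtain y0 r where r: "r > 0" "cball y0 r \<subseteq> F n"
    by (metis ex_in_conv mem_interior_cball)
  have "norm x \<le> 2 * real n / r" if x: "x \<in> S" for x
  proof -
    have "y0 + r *\<^sub>R sgn x \<in> cball y0 r" "y0 \<in> cball y0 r"
      using r(1) by (simp_all add: dist_norm norm_sgn)
    then have "y0 + r *\<^sub>R sgn x \<in> F n" "y0 \<in> F n" using r(2) by blast+
    then have "\<bar>inner x (y0 + r *\<^sub>R sgn x)\<bar> \<le> n" "\<bar>inner x y0\<bar> \<le> n" using x by (auto simp: F_def)
    then have "r * inner x (sgn x) \<le> 2 * n" by (simp add: inner_add_right)
    moreover have "inner x (sgn x) = norm x"
      by (cases "x = 0") (simp_all add: sgn_div_norm dot_square_norm power2_eq_square)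
    ultimately show ?thesis using r(1) by (simp add: field_simps)
  qed
  then show ?thesis by blast
qed

text \<open>If \<open>y = A\<^sup>* z\<close>, then \<open>\<langle>x, y\<rangle> = \<langle>A x, z\<rangle>\<close> is bounded by \<open>\<parallel>z\<parallel>\<close> on the set of all \<open>x\<close> with
  \<open>\<parallel>A x\<parallel> \<le> 1\<close>. This set is thus weakly bounded, hence bounded.\<close>

lemma adjoint_op_surj_imp_bounded_below:
  assumes A: "linear_op A" and surj: "Range (adjoint_op A) = UNIV"
  obtains C where "C > 0" "\<And>x w. (x, w) \<in> A \<Longrightarrow> norm x \<le> C * norm w"
proof -
  define S where "S = {x. \<exists>w. (x, w) \<in> A \<and> norm w \<le> 1}"
  have "\<exists>K. \<forall>x\<in>S. \<bar>inner x y\<bar> \<le> K" for y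
  proof -
    obtain z where z: "(z, y) \<in> adjoint_op A" using surj by blast
    have "\<bar>inner x y\<bar> \<le> norm z" if xS: "x \<in> S" for x
    proof -
      obtain w where w: "(x, w) \<in> A" "norm w \<le> 1" using xS by (auto simp: S_def)
      have "inner x y = inner w z" using z w(1) by (auto simp: adjoint_op_def inner_eq_Re_cinner)
      also have "\<bar>inner w z\<bar> \<le> norm w * norm z" by (rule Cauchy_Schwarz_ineq2)
      also have "\<dots> \<le> norm z" using w(2) by (simp add: mult_left_le_one_le)
      finally show ?thesis .
    qed
    then show ?thesis by blast
  qed
  then obtain K where K: "\<And>x. x \<in> S \<Longrightarrow> norm x \<le> K"
    using weakly_bounded_imp_norm_bounded by metis
  have "norm x \<le> (\<bar>K\<bar> + 1) * norm w" if xw: "(x, w) \<in> A" for x w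
  proof (rule field_le_epsilon)
    fix e :: real assume e: "e > 0"
    \<comment> \<open>The summand with \<open>e\<close> keeps \<open>c\<close> positive when \<open>w = 0\<close>.\<close>
    define c where "c = norm w + e / (\<bar>K\<bar> + 1)"
    have c: "c > 0" "norm w \<le> c" using e by (auto simp: c_def intro: add_nonneg_pos)
    have "(inverse c *\<^sub>R x, inverse c *\<^sub>R w) \<in> A"
      using subspace_scale[OF linear_op_imp_subspace[OF A] xw, of "inverse c"] by simp
    moreover have "norm (inverse c *\<^sub>R w) \<le> 1" using c by (simp add: field_simps)
    ultimately have "inverse c *\<^sub>R x \<in> S" unfolding S_def by blast
    then have "norm (inverse c *\<^sub>R x) \<le> K" by (rule K)
    then have "norm x \<le> K * c" using c by (simp add: field_simps)
    also have "\<dots> \<le> (\<bar>K\<bar> + 1) * c" using c by (intro mult_right_mono) auto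
    also have "\<dots> = (\<bar>K\<bar> + 1) * norm w + e" by (simp add: c_def field_simps)
    finally show "norm x \<le> (\<bar>K\<bar> + 1) * norm w + e" .
  qed
  then show thesis using that[of "\<bar>K\<bar> + 1"] by auto
qed

text \<open>The lower bound turns a convergent sequence of values into a Cauchy sequence of arguments.\<close>

lemma bounded_below_imp_closed_Range:
  fixes A :: "'a::complex_hilbert_space op_graph"
  assumes A: "linear_op A" "closed A"
    and C: "\<And>x w. (x, w) \<in> A \<Longrightarrow> norm x \<le> C * norm w"
  shows "closed (Range A)"
  unfolding closed_sequential_limits
proof (intro allI impI, elim conjE)
  fix w l assume "\<forall>n::nat. w n \<in> Range A" and wl: "w \<longlonglongrightarrow> l"
  then have "\<forall>n. \<exists>x. (x, w n) \<in> A" by (simp add: Range_iff)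
  then obtain x where xw: "\<And>n. (x n, w n) \<in> A" by metis
  have le: "dist (x m) (x n) \<le> (\<bar>C\<bar> + 1) * dist (w m) (w n)" for m n
  proof -
    have "(x m - x n, w m - w n) \<in> A"
      using subspace_diff[OF linear_op_imp_subspace[OF A(1)] xw xw, of m n] by simp
    then have "norm (x m - x n) \<le> C * norm (w m - w n)" by (rule C)
    also have "\<dots> \<le> (\<bar>C\<bar> + 1) * norm (w m - w n)" by (intro mult_right_mono) auto
    finally show ?thesis by (simp add: dist_norm)
  qed
  have "Cauchy x"
  proof (rule metric_CauchyI)
    fix e :: real assume "e > 0"
    then have "e / (\<bar>C\<bar> + 1) > 0" by simp
    then obtain M where M: "\<forall>m\<ge>M. \<forall>n\<ge>M. dist (w m) (w n) < e / (\<bar>C\<bar> + 1)"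
      using metric_CauchyD[OF LIMSEQ_imp_Cauchy[OF wl]] by blast
    have "dist (x m) (x n) < e" if "m \<ge> M" "n \<ge> M" for m n
    proof -
      have "dist (w m) (w n) < e / (\<bar>C\<bar> + 1)" using M that by blast
      then have "(\<bar>C\<bar> + 1) * dist (w m) (w n) < e"
        by (subst mult.commute) (simp only: pos_less_divide_eq abs_ge_zero add_nonneg_pos zero_less_one)
      then show ?thesis using le[of m n] by linarith
    qed
    then show "\<exists>M. \<forall>m\<ge>M. \<forall>n\<ge>M. dist (x m) (x n) < e" by blast
  qed
  then obtain k where "x \<longlonglongrightarrow> k" using Cauchy_convergent_iff convergent_def by blast
  then have "(\<lambda>n. (x n, w n)) \<longlonglongrightarrow> (k, l)" using wl by (rule tendsto_Pair)
  with A(2) xw have "(k, l) \<in> A" by (rule closed_sequentially)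
  then show "l \<in> Range A" by blast
qed

text \<open>Solving \<open>A\<^sup>* z = y\<close> means representing the functional \<open>A x \<mapsto> \<langle>x, y\<rangle>\<close> on the range of \<open>A\<close> by a
  vector \<open>z\<close>, as in the Riesz representation theorem. Unless the functional is zero, \<open>z\<close> is a
  multiple of a vector \<open>p = A x1\<close> orthogonal to its kernel; the lower bound makes this kernel closed.\<close>

lemma bounded_below_imp_adjoint_op_surj:
  assumes A: "linear_op A" "closed A"
    and C: "\<And>x w. (x, w) \<in> A \<Longrightarrow> norm x \<le> C * norm w"
  shows "Range (adjoint_op A) = UNIV"
proof -
  have lin: "(x + x', w + w') \<in> A" "(x - x', w - w') \<in> A" "(c *\<^sub>C x, c *\<^sub>C w) \<in> A"
    if "(x, w) \<in> A" "(x', w') \<in> A" for x w x' w' c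
    using that A(1) subspace_diff[OF linear_op_imp_subspace[OF A(1)] that]
    by (simp_all add: linear_op_def)
  have "\<exists>z. (z, y) \<in> adjoint_op A" for y
  proof (cases "\<forall>(x, w)\<in>A. cinner x y = 0")
    case True
    then have "(0, y) \<in> adjoint_op A" by (auto simp: adjoint_op_def)
    then show ?thesis ..
  next
    case False
    then obtain x' w' where "(x', w') \<in> A" "cinner x' y \<noteq> 0" by blast
    then have "((1 / cinner x' y) *\<^sub>C x', (1 / cinner x' y) *\<^sub>C w') \<in> A"
      "cinner ((1 / cinner x' y) *\<^sub>C x') y = 1"
      using lin(3) by (simp_all add: cinner_scaleC_left)
    then obtain x0 w0 where x0: "(x0, w0) \<in> A" "cinner x0 y = 1" by blast
    \<comment> \<open>The restriction of \<open>A\<close> to the vectors orthogonal to \<open>y\<close>; its range is the kernel of the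
      functional.\<close>
    define G where "G = A \<inter> {u. cinner (fst u) y = 0}"
    have "closed G"
      unfolding G_def by (intro closed_Int A(2) closed_Collect_eq continuous_intros)
    moreover have linG: "linear_op G"
      using A(1) unfolding linear_op_def G_def
      by (auto simp: single_valued_def cinner_add_left cinner_scaleC_left)
    ultimately have cl: "closed (Range G)"
      using C by (intro bounded_below_imp_closed_Range[of G C]) (auto simp: G_def)
    obtain k where k: "k \<in> Range G" "\<And>t. t \<in> Range G \<Longrightarrow> cinner t (w0 - k) = 0"
      using complex_orthogonal_decomposition[OF linear_op_imp_subspace_Range[OF linG] cl] by metis
    then obtain xk where xk: "(xk, k) \<in> A" "cinner xk y = 0" by (auto simp: G_def)
    define p x1 where "p = w0 - k" and "x1 = x0 - xk"
    have p: "(x1, p) \<in> A" "cinner x1 y = 1"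
      using lin(2) x0 xk by (auto simp: p_def x1_def cinner_diff_left)
    have "x1 \<noteq> 0" using p(2) by auto
    then have "p \<noteq> 0" using C[OF p(1)] by auto
    then have pp: "cinner p p \<noteq> 0" by (simp add: cinner_self)
    have "cinner w (cnj (1 / cinner p p) *\<^sub>C p) = cinner x y" if xw: "(x, w) \<in> A" for x w
    proof -
      define c where "c = cinner x y"
      have "(x - c *\<^sub>C x1, w - c *\<^sub>C p) \<in> G"
        using lin(2)[OF xw lin(3)[OF p(1) p(1)]] p(2)
        by (simp add: G_def c_def cinner_diff_left cinner_scaleC_left)
      then have "cinner (w - c *\<^sub>C p) p = 0" using k(2) by (auto simp: p_def)
      then show ?thesis
        using pp by (simp add: c_def cinner_diff_left cinner_scaleC_left cinner_scaleC_right)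
    qed
    then have "(cnj (1 / cinner p p) *\<^sub>C p, y) \<in> adjoint_op A" by (auto simp: adjoint_op_def)
    then show ?thesis ..
  qed
  then show ?thesis by blast
qed

section \<open>The operator norm with respect to the graph norm\<close>

lemma graph_norm_eq: "graph_norm T x = sqrt ((norm x)\<^sup>2 + (norm (op_app T x))\<^sup>2)"
  by (simp add: graph_norm_def graph_inner_def cinner_self)

lemma graph_norm_nonneg: "0 \<le> graph_norm T x"
  by (simp add: graph_norm_eq)

lemma op_app_scaleR:
  assumes "linear_op T" "x \<in> Domain T"
  shows "op_app T (r *\<^sub>R x) = r *\<^sub>R op_app T x"
proof -
  obtain y where y: "(x, y) \<in> T" using assms(2) by blast
  then have "(r *\<^sub>R x, r *\<^sub>R y) \<in> T" using assms(1) by (simp add: linear_op_def scaleR_scaleC)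
  then show ?thesis using y assms(1) op_app_eq unfolding linear_op_def by metis
qed

lemma graph_norm_scaleR:
  assumes "linear_op T" "x \<in> Domain T"
  shows "graph_norm T (r *\<^sub>R x) = \<bar>r\<bar> * graph_norm T x"
proof -
  have "(norm (r *\<^sub>R x))\<^sup>2 + (norm (r *\<^sub>R op_app T x))\<^sup>2 = r\<^sup>2 * ((norm x)\<^sup>2 + (norm (op_app T x))\<^sup>2)"
    by (simp add: power_mult_distrib algebra_simps)
  then show ?thesis by (simp add: graph_norm_eq op_app_scaleR[OF assms] real_sqrt_mult)
qed

lemma bounded_wrt_diff:
  assumes "bounded_wrt D N f" "bounded_wrt D N g"
  shows "bounded_wrt D N (\<lambda>x. f x - g x)"
proof -
  obtain B C where "\<forall>x\<in>D. norm (f x) \<le> B * N x" "\<forall>x\<in>D. norm (g x) \<le> C * N x"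
    using assms by (auto simp: bounded_wrt_def)
  then have "\<forall>x\<in>D. norm (f x - g x) \<le> (B + C) * N x"
    by (auto simp: distrib_right intro: order_trans[OF norm_triangle_ineq4 add_mono])
  then show ?thesis unfolding bounded_wrt_def ..
qed

text \<open>Boundedness makes the supremum defining \<open>opnorm_wrt\<close> exist; homogeneity carries the estimate from
  the unit ball to all of \<open>D\<close>. If \<open>N x = 0\<close>, boundedness alone gives \<open>f x = 0\<close>.\<close>

lemma norm_le_opnorm_wrt:
  assumes bdd: "bounded_wrt D N f" and nonneg: "\<And>x. 0 \<le> N x"
    and D: "\<And>r x. x \<in> D \<Longrightarrow> r *\<^sub>R x \<in> D"
    and N: "\<And>r x. x \<in> D \<Longrightarrow> N (r *\<^sub>R x) = \<bar>r\<bar> * N x"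
    and f: "\<And>r x. x \<in> D \<Longrightarrow> f (r *\<^sub>R x) = r *\<^sub>R f x"
    and x: "x \<in> D"
  shows "norm (f x) \<le> opnorm_wrt D N f * N x"
proof -
  obtain C where C: "\<And>x. x \<in> D \<Longrightarrow> norm (f x) \<le> C * N x" using bdd by (auto simp: bounded_wrt_def)
  show ?thesis
  proof (cases "N x = 0")
    case True
    then show ?thesis using C[OF x] by simp
  next
    case False
    then have pos: "N x > 0" using nonneg[of x] by simp
    have "norm (f u) \<le> \<bar>C\<bar>" if "u \<in> D" "N u \<le> 1" for u
    proof -
      have "C * N u \<le> \<bar>C\<bar> * N u" using nonneg by (intro mult_right_mono) auto
      also have "\<dots> \<le> \<bar>C\<bar>" using nonneg that(2) by (simp add: mult_left_le)
      finally show ?thesis using C[OF that(1)] by linarith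
    qed
    then have "bdd_above ((\<lambda>u. norm (f u)) ` {u \<in> D. N u \<le> 1})" by (intro bdd_aboveI) auto
    moreover have "inverse (N x) *\<^sub>R x \<in> {u \<in> D. N u \<le> 1}" using x pos by (simp add: D N)
    ultimately have "norm (f (inverse (N x) *\<^sub>R x)) \<le> opnorm_wrt D N f"
      unfolding opnorm_wrt_def by (rule cSUP_upper[rotated])
    then show ?thesis using pos by (simp add: f x field_simps)
  qed
qed

section \<open>Stability under small perturbations\<close>

text \<open>A lower bound \<open>\<parallel>x\<parallel> \<le> C \<parallel>A x\<parallel>\<close> makes the graph norm of \<open>A\<close> equivalent to \<open>\<parallel>A x\<parallel>\<close>, so a
  perturbation that is small in the graph norm changes \<open>\<parallel>A x\<parallel>\<close> by at most half.\<close>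

lemma norm_le_of_graph_norm_close:
  fixes x w w' :: "'a::real_normed_vector"
  assumes "norm x \<le> C * norm w" "C > 0"
    and "norm (w' - w) \<le> e * sqrt ((norm x)\<^sup>2 + (norm w)\<^sup>2)" "e \<ge> 0" "e * (C + 1) \<le> 1 / 2"
  shows "norm x \<le> 2 * C * norm w'"
proof -
  have "sqrt ((norm x)\<^sup>2 + (norm w)\<^sup>2) \<le> (C + 1) * norm w"
    using sqrt_sum_squares_le_sum[of "norm x" "norm w"] assms(1) by (simp add: algebra_simps)
  then have "e * sqrt ((norm x)\<^sup>2 + (norm w)\<^sup>2) \<le> e * ((C + 1) * norm w)"
    using assms(4) by (rule mult_left_mono)
  then have "norm (w' - w) \<le> e * (C + 1) * norm w"
    using assms(3) by (simp only: mult.assoc)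
  also have "\<dots> \<le> 1 / 2 * norm w" using assms(5) by (intro mult_right_mono) auto
  finally have "norm w \<le> 2 * norm w'"
    using norm_triangle_ineq2[of w w'] by (simp add: norm_minus_commute)
  then have "C * norm w \<le> C * (2 * norm w')" using assms(2) by simp
  then show ?thesis using assms(1) by simp
qed

theorem lemma3p2:
  fixes A :: "real \<Rightarrow> 'a::complex_hilbert_space op_graph"
    and D\<^sub>m D\<^sub>m\<^sub>a\<^sub>x :: "'a set"
  assumes "\<And>s. s \<in> {0..1} \<Longrightarrow> linear_op (A s)"
    and "\<And>s. s \<in> {0..1} \<Longrightarrow> closed (A s)"
    and "\<And>s. s \<in> {0..1} \<Longrightarrow> densely_defined (A s)"
    and "\<And>s. s \<in> {0..1} \<Longrightarrow> symmetric_op (A s)"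
    and "\<And>s. s \<in> {0..1} \<Longrightarrow> Domain (A s) = D\<^sub>m"
    and "\<And>s. s \<in> {0..1} \<Longrightarrow> Domain (adjoint_op (A s)) = D\<^sub>m\<^sub>a\<^sub>x"
    and "continuous_bounded_curve {0..1} D\<^sub>m\<^sub>a\<^sub>x (graph_norm (adjoint_op (A 0)))
           (\<lambda>s. op_app (adjoint_op (A s)))"
    and "weak_inner_UCP (A 0)"
    and "\<exists>D \<subseteq> D\<^sub>m\<^sub>a\<^sub>x. A 0 \<subseteq> op_restrict (adjoint_op (A 0)) D
           \<and> selfadjoint_op (op_restrict (adjoint_op (A 0)) D)
           \<and> fredholm_op (op_restrict (adjoint_op (A 0)) D)"
  shows "\<exists>\<delta>>0. \<forall>s\<in>{0..1}. s < \<delta> \<longrightarrow>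
           Range (adjoint_op (A s)) = UNIV \<and> weak_inner_UCP (A s)"
proof -
  define T where "T s = adjoint_op (A s)" for s
  have linT: "linear_op (T s)" if "s \<in> {0..1}" for s
    unfolding T_def using linear_op_adjoint_op assms(3)[OF that] .
  have app: "op_app (T s) x = w" if "s \<in> {0..1}" "(x, w) \<in> A s" for s x w
  proof -
    have "(x, w) \<in> T s" using assms(4)[OF that(1)] that(2) by (auto simp: T_def symmetric_op_def)
    then show ?thesis using linT[OF that(1)] by (intro op_app_eq) (simp_all add: linear_op_def)
  qed
  have domT: "Domain (T s) = D\<^sub>m\<^sub>a\<^sub>x" if "s \<in> {0..1}" for s
    using assms(6)[OF that] by (simp add: T_def)

  \<comment> \<open>Finite codimension passes from the range of the Fredholm extension to the larger range of
    \<open>T 0\<close>, and closedness with it.\<close>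
  obtain D where "fredholm_op (op_restrict (T 0) D)" using assms(9) by (auto simp: T_def)
  moreover have "Range (op_restrict (T 0) D) \<subseteq> Range (T 0)" by (auto simp: op_restrict_def)
  ultimately have "closed (Range (T 0))"
    using closed_superspace_of_fin_codim[OF linear_op_imp_subspace_Range] subspace_Range_adjoint_op
    unfolding fredholm_op_def T_def by metis
  then have "Range (adjoint_op (A 0)) = UNIV"
    using assms(1,2,8) by (intro Range_adjoint_op_eq_UNIV) (auto simp: weak_inner_UCP_def T_def)
  then obtain C where C: "C > 0" "\<And>x w. (x, w) \<in> A 0 \<Longrightarrow> norm x \<le> C * norm w"
    using adjoint_op_surj_imp_bounded_below[OF assms(1)[of 0]] by auto

  let ?N = "graph_norm (T 0)"
  define dist_op where "dist_op s = opnorm_wrt D\<^sub>m\<^sub>a\<^sub>x ?N (\<lambda>x. op_app (T s) x - op_app (T 0) x)" for s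
  \<comment> \<open>The relative size of a perturbation that a lower bound with constant \<open>C\<close> survives.\<close>
  define e where "e = 1 / (2 * (C + 1))"
  have e: "e > 0" "e * (C + 1) \<le> 1 / 2" using C(1) by (auto simp: e_def)
  have diff: "norm (op_app (T s) x - op_app (T 0) x) \<le> dist_op s * ?N x"
    if s: "s \<in> {0..1}" and x: "x \<in> D\<^sub>m\<^sub>a\<^sub>x" for s x
    unfolding dist_op_def
  proof (rule norm_le_opnorm_wrt[where f = "\<lambda>x. op_app (T s) x - op_app (T 0) x"])
    show "bounded_wrt D\<^sub>m\<^sub>a\<^sub>x ?N (\<lambda>x. op_app (T s) x - op_app (T 0) x)"
      using assms(7) s by (intro bounded_wrt_diff) (auto simp: continuous_bounded_curve_def T_def)
    fix r u assume u: "u \<in> D\<^sub>m\<^sub>a\<^sub>x"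
    have u': "u \<in> Domain (T s)" "u \<in> Domain (T 0)" using u domT[OF s] domT[of 0] by auto
    show "r *\<^sub>R u \<in> D\<^sub>m\<^sub>a\<^sub>x"
      using u'(1) linT[OF s] unfolding domT[OF s, symmetric] linear_op_def scaleR_scaleC by blast
    show "?N (r *\<^sub>R u) = \<bar>r\<bar> * ?N u"
      using u'(2) linT[of 0] by (intro graph_norm_scaleR) auto
    show "op_app (T s) (r *\<^sub>R u) - op_app (T 0) (r *\<^sub>R u) = r *\<^sub>R (op_app (T s) u - op_app (T 0) u)"
      using u' linT[OF s] linT[of 0] by (simp add: op_app_scaleR scaleR_diff_right)
  qed (use x graph_norm_nonneg in auto)

  have "(dist_op \<longlongrightarrow> 0) (at 0 within {0..1})"
    using assms(7) unfolding continuous_bounded_curve_def dist_op_def T_def by force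
  then have "\<forall>\<^sub>F s in at 0 within {0..1}. dist_op s < e" using e(1) by (rule order_tendstoD)
  then obtain \<delta> where \<delta>: "\<delta> > 0" "\<And>s. s \<in> {0..1} \<Longrightarrow> s \<noteq> 0 \<Longrightarrow> s < \<delta> \<Longrightarrow> dist_op s < e"
    by (auto simp: eventually_at dist_real_def)
  have "Range (adjoint_op (A s)) = UNIV \<and> weak_inner_UCP (A s)" if s: "s \<in> {0..1}" "s < \<delta>" for s
  proof -
    have close: "norm (op_app (T s) x - op_app (T 0) x) \<le> e * ?N x" if "x \<in> D\<^sub>m\<^sub>a\<^sub>x" for x
      \<comment> \<open>The limit of \<open>dist_op\<close> at 0 says nothing about its value there.\<close>
    proof (cases "s = 0")
      case True
      then show ?thesis using e(1) graph_norm_nonneg[of "T 0" x] by simp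
    next
      case False
      then have "dist_op s * ?N x \<le> e * ?N x"
        using \<delta>(2)[OF s(1) _ s(2)] graph_norm_nonneg by (intro mult_right_mono) auto
      then show ?thesis using diff[OF s(1) that] by linarith
    qed
    \<comment> \<open>By symmetry the values of \<open>A s\<close> and \<open>A 0\<close> at a point of the common domain are those of
      \<open>T s\<close> and \<open>T 0\<close>, so the estimate for the adjoints applies.\<close>
    have bound: "norm x \<le> 2 * C * norm w'" if xw': "(x, w') \<in> A s" for x w'
    proof -
      obtain w where xw: "(x, w) \<in> A 0" using xw' assms(5)[OF s(1)] assms(5)[of 0] by auto
      then have app0: "op_app (T 0) x = w" by (intro app) auto
      have "x \<in> D\<^sub>m\<^sub>a\<^sub>x"
        using xw assms(4)[of 0] assms(6)[of 0] by (auto simp: symmetric_op_def)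
      then have "norm (w' - w) \<le> e * sqrt ((norm x)\<^sup>2 + (norm w)\<^sup>2)"
        using close app[OF s(1) xw'] app0 by (fastforce simp: graph_norm_eq)
      then show ?thesis
        using C(2)[OF xw] C(1) e by (intro norm_le_of_graph_norm_close) auto
    qed
    have "op_ker (A s) = {0}"
      using bound assms(1)[OF s(1)] by (force simp: op_ker_def linear_op_def)
    then show ?thesis
      using bounded_below_imp_adjoint_op_surj[OF assms(1,2)[OF s(1)] bound]
      by (simp add: weak_inner_UCP_def)
  qed
  then show ?thesis using \<delta>(1) by blast
qed

end
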